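(* For every integer $d\ge 1$ there exist a constant $c_d$ with $0<c_d\le \frac12$ and a constant $C_d$, both depending only on $d$, such that the following holds for every integer $N\ge 3$. List all eigenvalues of $T^d_N$ (with multiplicity) as $\mu_1\ge\mu_2\ge\cdots\ge\mu_{N^d}$. If $k$ is an integer in $[1,c_dN^d)\cup((1-c_d)N^d,N^d]$, then $m_{T^d_N}(\mu_k)\le C_d$.
   Context: For integers $N\ge 3$ and $d\ge 1$, $T^d_N$ is the Cayley graph of $(\mathbb{Z}/N\mathbb{Z})^d$ with generating set $\{\pm e_1,\dots,\pm e_d\}$, $e_i$ being the canonical basis vectors. The eigenvalues of $T^d_N$ are those of its adjacency matrix, namely the $N^d$ numbers $\mu(k_1,\dots,k_d)=2\sum_{j=1}^d\cos\frac{2k_j\pi}{N}$ for $(k_1,\dots,k_d)\in(\mathbb{Z}/N\mathbb{Z})^d$. The multiplicity $m_{T^d_N}(\mu)$ is the number of tuples $(k_1,\dots,k_d)\in(\mathbb{Z}/N\mathbb{Z})^d$ with $\mu(k_1,\dots,k_d)=\mu$. *)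

theory Defs
  imports
    Complex_Main
    "HOL-Library.Countable_Set"
    "HOL-Algebra.Elementary_Groups"
    "HOL-Algebra.Product_Groups"
    "HOL-Computational_Algebra.Polynomial"
    "Jordan_Normal_Form.Char_Poly"
begin

definition cayley_adj :: "('a, 'b) monoid_scheme \<Rightarrow> 'a set \<Rightarrow> 'a \<Rightarrow> 'a \<Rightarrow> bool" where
  "cayley_adj G S u v \<longleftrightarrow>
     u \<in> carrier G \<and> v \<in> carrier G \<and> (\<exists>s\<in>S. v = u \<otimes>\<^bsub>G\<^esub> s)"

(* Matrices of the library are indexed by {0..<n}, so the finite vertex set V is enumerated by
   from_nat_into V, which is a bijection from {..<card V} onto V. Another enumeration would
   conjugate the matrix by a permutation matrix and leave its spectrum unchanged. *)
definition adjacency_matrix :: "'a set \<Rightarrow> ('a \<Rightarrow> 'a \<Rightarrow> bool) \<Rightarrow> real mat" where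
  "adjacency_matrix V E = mat (card V) (card V)
     (\<lambda>(i, j). if E (from_nat_into V i) (from_nat_into V j) then 1 else 0)"

(* Real eigenvalues, repeated according to algebraic multiplicity, largest first. For a symmetric
   matrix all the eigenvalues are real and the list has as many entries as the matrix has rows. *)
definition eigenvalues_desc :: "real mat \<Rightarrow> real list" where
  "eigenvalues_desc A = rev (sorted_list_of_multiset (proots (char_poly A)))"

(* (Z/NZ)^d; an element is a function on {1..d} with values in the representatives {0..<N},
   extensional outside {1..d}. *)
definition torus_group :: "nat \<Rightarrow> nat \<Rightarrow> (nat \<Rightarrow> int) monoid" where
  "torus_group d N = product_group {1..d} (\<lambda>_. integer_mod_group N)"

definition basis_vec :: "nat \<Rightarrow> nat \<Rightarrow> nat \<Rightarrow> int" where
  "basis_vec d i = (\<lambda>j\<in>{1..d}. if j = i then 1 else 0)"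

definition torus_generators :: "nat \<Rightarrow> nat \<Rightarrow> (nat \<Rightarrow> int) set" where
  "torus_generators d N =
     (\<Union>i\<in>{1..d}. {basis_vec d i, inv\<^bsub>torus_group d N\<^esub> (basis_vec d i)})"

definition torus_adjacency_matrix :: "nat \<Rightarrow> nat \<Rightarrow> real mat" where
  "torus_adjacency_matrix d N = adjacency_matrix (carrier (torus_group d N))
     (cayley_adj (torus_group d N) (torus_generators d N))"

(* 1-based: the k-th largest eigenvalue of the torus graph, counted with multiplicity. *)
definition torus_eigenvalue :: "nat \<Rightarrow> nat \<Rightarrow> nat \<Rightarrow> real" where
  "torus_eigenvalue d N k = eigenvalues_desc (torus_adjacency_matrix d N) ! (k - 1)"

definition torus_mu :: "nat \<Rightarrow> nat \<Rightarrow> (nat \<Rightarrow> int) \<Rightarrow> real" where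
  "torus_mu d N k = 2 * (\<Sum>j = 1..d. cos (2 * of_int (k j) * pi / of_nat N))"

definition torus_multiplicity :: "nat \<Rightarrow> nat \<Rightarrow> real \<Rightarrow> nat" where
  "torus_multiplicity d N \<mu> = card {k \<in> carrier (torus_group d N). torus_mu d N k = \<mu>}"

end

theory Submission
  imports Defs "HOL-Number_Theory.Residues"
begin

text \<open>If \<open>\<mu> > 2 d - 2\<close> (or \<open>\<mu> < - (2 d - 2)\<close>) and \<open>\<mu>(l) = \<mu>\<close>, all cosines in \<open>\<mu>(l)\<close> have the same strict
  sign. For a fixed \<open>k\<close> with \<open>\<mu>(k) = \<mu>\<close>, the equation \<open>\<mu>(k) - \<mu>(l) = 0\<close> is a vanishing sum of \<open>4 d\<close>
  roots of unity up to sign, and it splits into minimal ones. None of these consists of terms of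
  \<open>l\<close> only, because the real parts of such a sum cannot cancel. By Mann's theorem the quotients of
  the roots of unity in a minimal vanishing sum have an order dividing \<open>(4 d)!\<close>, so every coordinate
  of \<open>l\<close> is determined by \<open>k\<close> up to boundedly many choices. Finally, a positive proportion of all tuples has its
  eigenvalue above \<open>2 d - 2\<close>, and, for large \<open>N\<close>, a positive proportion has it below \<open>- (2 d - 2)\<close>.\<close>

section \<open>Galois conjugation of relations between roots of unity\<close>

text \<open>The inner binomial coefficients are divisible by the prime \<open>p\<close>, and
  Fermat's little theorem handles each coefficient; induction on the coefficients combines the
  two.\<close>

lemma frobenius_int_poly:
  fixes F :: "int poly"
  assumes "prime p"
  shows "[:int p:] dvd F ^ p - pcompose F (Polynomial.monom 1 p)"
proof -
  have add: "[:int p:] dvd (a + b) ^ p - (a ^ p + b ^ p)" for a b :: "int poly"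
  proof -
    have p2: "p \<ge> 2" using assms prime_ge_2_nat by blast
    have S: "{..p} = insert 0 (insert p {1..<p})" using p2 by auto
    have "(a + b) ^ p = (\<Sum>k\<le>p. of_nat (p choose k) * a ^ k * b ^ (p - k))"
      by (rule binomial_ring)
    also have "\<dots> = b ^ p + (a ^ p + (\<Sum>k=1..<p. of_nat (p choose k) * a ^ k * b ^ (p - k)))"
      unfolding S using p2 by (subst sum.insert; simp)+
    finally have "(a + b) ^ p - (a ^ p + b ^ p)
        = (\<Sum>k=1..<p. of_nat (p choose k) * a ^ k * b ^ (p - k))" by simp
    moreover have "[:int p:] dvd of_nat (p choose k) * a ^ k * b ^ (p - k)" if "k \<in> {1..<p}" for k
    proof -
      have "p dvd (p choose k)" using that assms by (intro dvd_choose_prime) auto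
      then obtain l where "p choose k = p * l" by blast
      hence "of_nat (p choose k) * a ^ k * b ^ (p - k)
          = [:int p:] * (of_nat l * a ^ k * b ^ (p - k))"
        by (simp add: of_nat_poly mult.assoc mult.commute[of "int l"])
      thus ?thesis by (metis dvd_triv_left)
    qed
    ultimately show ?thesis by (metis (no_types, lifting) dvd_sum)
  qed
  show ?thesis
  proof (induction F)
    case 0
    then show ?case using prime_gt_0_nat[OF assms] by (simp add: power_0_left)
  next
    case (pCons a F)
    have "[a ^ p = a] (mod int p)"
    proof (cases "int p dvd a")
      case True
      then have "int p dvd a ^ p" using prime_gt_0_nat[OF assms] by (meson dvd_power dvd_trans)
      with True show ?thesis by (simp add: cong_iff_dvd_diff)
    next
      case False
      have p0: "p > 0" using prime_gt_0_nat[OF assms] .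
      define b where "b = nat (a mod int p)"
      have ab: "[a = int b] (mod int p)" using p0 by (simp add: b_def cong_def)
      have "\<not> p dvd b" using False ab by (metis cong_dvd_iff int_dvd_int_iff)
      from fermat_theorem[OF assms this] have "[int b ^ (p - 1) = 1] (mod int p)"
        by (metis cong_int_iff of_nat_1 of_nat_power)
      hence "[int b ^ (p - 1) * int b = 1 * int b] (mod int p)" by (rule cong_scalar_right)
      hence "[int b ^ p = int b] (mod int p)" using p0 by (metis power_minus_mult mult_1)
      thus ?thesis using ab by (meson cong_pow cong_sym cong_trans)
    qed
    hence "int p dvd a ^ p - a" by (simp add: cong_iff_dvd_diff)
    hence 1: "[:int p:] dvd [:a:] ^ p - [:a:]" by (simp add: poly_const_pow)
    have 2: "[:int p:] dvd Polynomial.monom 1 p * (F ^ p - pcompose F (Polynomial.monom 1 p))"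
      by (rule dvd_mult[OF pCons.IH])
    have e: "pCons a F = [:a:] + Polynomial.monom 1 1 * F" by (simp add: monom_altdef)
    \<comment> \<open>Three errors add up: the mixed terms of the \<open>p\<close>-th power, the
      constant coefficient, and the tail covered by the induction hypothesis.\<close>
    have "pCons a F ^ p - pcompose (pCons a F) (Polynomial.monom 1 p)
       = ((pCons a F) ^ p - ([:a:] ^ p + (Polynomial.monom 1 1 * F) ^ p)) + ([:a:] ^ p - [:a:])
         + Polynomial.monom 1 p * (F ^ p - pcompose F (Polynomial.monom 1 p))"
      by (simp add: pcompose_pCons power_mult_distrib monom_power algebra_simps)
    also have "[:int p:] dvd \<dots>"
      by (intro dvd_add 1 2) (unfold e, rule add)
    finally show ?case .
  qed
qed

text \<open>Gauss's lemma: the content is multiplicative, so \<open>a\<close> divides the content of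
  the cofactor and cancels. This removes the multiplier that pseudo-division introduces.\<close>

lemma dvd_smult_primitive:
  fixes f F :: "int poly"
  assumes "content f = 1" "f dvd Polynomial.smult a F" "a \<noteq> 0"
  shows "f dvd F"
proof -
  obtain q where q: "Polynomial.smult a F = f * q" using assms(2) by blast
  have "content q = content (f * q)" using assms(1) by (simp add: content_mult)
  also have "\<dots> = content (Polynomial.smult a F)" by (simp add: q)
  finally have "a dvd content q" by (simp)
  hence "[:a:] dvd q" by (simp add: const_poly_dvd_iff_dvd_content)
  then obtain q' where "q = Polynomial.smult a q'" by auto
  with q have "Polynomial.smult a F = Polynomial.smult a (f * q')" by simp
  with \<open>a \<noteq> 0\<close> have "F = f * q'" by (metis smult_cancel)
  thus ?thesis by simp
qed

text \<open>Take the primitive part of a nonzero integer polynomial of least degree vanishing at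
  \<open>z\<close>. Pseudo-remainders modulo it vanish at \<open>z\<close> too, so they are zero by
  minimality, and primitivity yields divisibility over the integers.\<close>

lemma integer_minimal_polynomial:
  fixes z :: complex
  assumes "F0 \<noteq> 0" "poly (of_int_poly F0) z = 0"
  obtains f :: "int poly" where "f \<noteq> 0" "poly (of_int_poly f) z = 0"
    "\<And>F. poly (of_int_poly F) z = 0 \<Longrightarrow> f dvd F"
proof -
  define V where "V = (\<lambda>F :: int poly. F \<noteq> 0 \<and> poly (of_int_poly F) z = 0)"
  obtain g where g: "V g" "\<And>F. V F \<Longrightarrow> degree g \<le> degree F"
    using exists_least_iff[of "\<lambda>n. \<exists>F. V F \<and> degree F = n"] assms
    by (metis V_def linorder_not_less)
  define f where "f = primitive_part g"
  have g0: "g \<noteq> 0" using g by (simp add: V_def)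
  have f1: "content f = 1" using g0 by (simp add: f_def)
  have gf: "g = Polynomial.smult (content g) f" by (simp add: f_def)
  have fz: "poly (of_int_poly f) z = 0"
  proof -
    have "poly (of_int_poly g) z = of_int (content g) * poly (of_int_poly f) z"
      by (subst gf) (simp add: hom_distribs)
    thus ?thesis using g(1) g0 by (simp add: V_def)
  qed
  have f0: "f \<noteq> 0" using g0 by (simp add: f_def)
  have deg: "degree f \<le> degree F" if "V F" for F using g(2)[OF that] by (simp add: f_def)
  have "f dvd F" if F: "poly (of_int_poly F) z = 0" for F
  proof -
    define r where "r = pseudo_mod F f"
    from pseudo_mod[OF f0, of F, folded r_def]
    obtain a q where aq: "a \<noteq> 0" "Polynomial.smult a F = f * q + r" and r: "r = 0 \<or> degree r < degree f"
      by auto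
    have "poly (of_int_poly (Polynomial.smult a F)) z = poly (of_int_poly r) z"
      unfolding aq(2) by (simp add: hom_distribs fz)
    hence "poly (of_int_poly r) z = 0" using F by (simp add: hom_distribs)
    with r deg[of r] have "r = 0" unfolding V_def by linarith
    with aq f1 show ?thesis by (metis add_0_right dvd_smult_primitive dvd_triv_left)
  qed
  with f0 fz that show thesis by blast
qed

text \<open>Let \<open>f\<close> be the minimal polynomial of \<open>z\<close> and \<open>x ^ m - 1 = f * g\<close>. If \<open>f (z ^ p) \<noteq> 0\<close>, then
  \<open>g (z ^ p) = 0\<close>, so the Frobenius congruence puts \<open>g z ^ p\<close> into \<open>p \<int>[z]\<close>. Differentiating the
  factorization at \<open>z\<close> shows that \<open>g z\<close> divides \<open>m\<close> in \<open>\<int>[z]\<close>, hence \<open>m ^ p \<in> p \<int>[z]\<close>. As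
  \<open>f\<close> is monic up to sign, this forces \<open>p\<close> to divide \<open>m ^ p\<close> in \<open>\<int>\<close>.\<close>
lemma root_of_unity_conjugate_prime:
  fixes z :: complex
  assumes z: "z ^ m = 1" and m: "m > 0" and p: "prime p" "\<not> p dvd m"
    and F: "poly (of_int_poly F) z = 0"
  shows "poly (of_int_poly F) (z ^ p) = 0"
proof -
  define X :: "int poly" where "X = Polynomial.monom 1 m - 1"
  have polyX: "poly (of_int_poly X) w = w ^ m - 1" for w :: complex
    by (simp add: X_def hom_distribs poly_monom)
  have X0: "X \<noteq> 0"
    using m by (metis X_def degree_1 degree_monom_eq eq_iff_diff_eq_0 less_irrefl zero_neq_one)
  obtain f where f0: "f \<noteq> 0" and fz: "poly (of_int_poly f) z = 0"
    and fdvd: "\<And>F. poly (of_int_poly F) z = 0 \<Longrightarrow> f dvd F"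
    by (rule integer_minimal_polynomial[of X z]) (use X0 polyX z in auto)
  have "f dvd X" using z by (intro fdvd) (simp add: polyX)
  then obtain g where g: "X = f * g" by blast
  \<comment> \<open>\<open>X\<close> is monic, so the integer leading coefficients of
    \<open>f\<close> and \<open>g\<close> have product 1 and are units.\<close>
  have "lead_coeff f * lead_coeff g = lead_coeff X" by (simp add: g lead_coeff_mult)
  also have "lead_coeff X = 1"
  proof -
    have "degree X = m" unfolding X_def using m
      by (metis degree_1 degree_diff_less degree_monom_eq one_neq_zero degree_add_eq_left degree_minus diff_conv_add_uminus)
    thus ?thesis using m by (simp add: X_def)
  qed
  finally have lf: "\<bar>lead_coeff f\<bar> = 1" by (metis abs_mult abs_1 zmult_eq_1_iff abs_zmult_eq_1)
  have degf: "degree f > 0"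
  proof (rule ccontr)
    assume "\<not> degree f > 0"
    then obtain c where "f = [:c:]" by (metis degree_eq_zeroE gr0I)
    with fz f0 show False by (simp add: hom_distribs)
  qed
  have "poly (of_int_poly f) (z ^ p) = 0"
  proof (rule ccontr)
    assume nz: "poly (of_int_poly f) (z ^ p) \<noteq> 0"
    have "poly (of_int_poly X) (z ^ p) = 0"
      using z by (simp add: polyX flip: power_mult) (simp add: mult.commute[of p] power_mult)
    hence gzp: "poly (of_int_poly g) (z ^ p) = 0" using nz by (simp add: g hom_distribs)
    obtain h where h: "g ^ p - pcompose g (Polynomial.monom 1 p) = [:int p:] * h"
      using frobenius_int_poly[OF p(1), of g] by blast
    have "poly (of_int_poly (g ^ p - pcompose g (Polynomial.monom 1 p))) z = poly (of_int_poly g) z ^ p"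
      by (simp add: hom_distribs of_int_poly_hom.hom_minus poly_pcompose poly_monom gzp of_int_hom.map_poly_pcompose)
    hence gp: "poly (of_int_poly g) z ^ p = of_nat p * poly (of_int_poly h) z"
      unfolding h by (simp add: hom_distribs)
    have "pderiv X = f * pderiv g + g * pderiv f" by (simp add: g pderiv_mult)
    moreover have "pderiv X = Polynomial.monom (int m) (m - 1)" by (simp add: X_def pderiv_diff pderiv_monom)
    ultimately have "poly (of_int_poly (Polynomial.monom (int m) (m - 1))) z
        = poly (of_int_poly (f * pderiv g + g * pderiv f)) z" by simp
    hence "of_nat m * z ^ (m - 1) = poly (of_int_poly g) z * poly (of_int_poly (pderiv f)) z"
      by (simp add: hom_distribs poly_monom fz)
    hence "of_nat m * z ^ (m - 1) * z = poly (of_int_poly g) z * poly (of_int_poly (pderiv f)) z * z"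
      by simp
    moreover have "z ^ (m - 1) * z = 1" using z m by (metis power_minus_mult)
    ultimately have "of_nat m = poly (of_int_poly g) z * poly (of_int_poly (pderiv f)) z * z"
      by (metis (no_types, lifting) mult.assoc mult.right_neutral)
    hence mp: "(of_nat m :: complex) ^ p = (poly (of_int_poly g) z * poly (of_int_poly (pderiv f)) z * z) ^ p"
      by simp
    define H where "H = h * pderiv f ^ p * Polynomial.monom 1 p"
    have Hz: "of_nat p * poly (of_int_poly H) z = of_nat m ^ p"
      unfolding mp by (simp add: power_mult_distrib gp hom_distribs poly_monom H_def)
    obtain q r where qr: "pseudo_divmod H f = (q, r)" by fastforce
    define a where "a = lead_coeff f ^ (Suc (degree H) - degree f)"
    have aH: "Polynomial.smult a H = f * q + r" and r: "r = 0 \<or> degree r < degree f"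
      using pseudo_divmod[OF f0 qr] by (simp_all add: a_def)
    have a1: "\<bar>a\<bar> = 1" using lf by (simp add: a_def power_abs)
    \<comment> \<open>\<open>R\<close> vanishes at \<open>z\<close> and has smaller degree than
      \<open>f\<close>, so it is the zero polynomial. Its constant coefficient then gives a
      divisibility between integers.\<close>
    define R where "R = Polynomial.smult (int p) r - [:a * int (m ^ p):]"
    have "of_int a * poly (of_int_poly H) z = poly (of_int_poly (Polynomial.smult a H)) z"
      by (simp add: hom_distribs)
    also have "\<dots> = poly (of_int_poly r) z"
      unfolding aH by (simp add: hom_distribs fz)
    finally have "poly (of_int_poly R) z = of_int a * (of_nat p * poly (of_int_poly H) z - of_nat m ^ p)"
      by (simp add: R_def hom_distribs of_int_poly_hom.hom_minus algebra_simps)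
    also have "\<dots> = 0" using Hz by simp
    finally have "f dvd R" by (rule fdvd)
    moreover have "degree R < degree f"
      using r degf by (auto simp: R_def intro!: degree_diff_less)
    ultimately have "R = 0" by (meson dvd_imp_degree_le linorder_not_less)
    hence "int p * Polynomial.coeff r 0 = a * int (m ^ p)"
      by (metis R_def coeff_pCons_0 coeff_smult eq_iff_diff_eq_0)
    hence "int p dvd a * int (m ^ p)" by (metis dvd_triv_left)
    moreover have "is_unit a" using a1 by simp
    ultimately have "int p dvd int (m ^ p)" by (meson dvd_mult_unit_iff' )
    hence "p dvd m ^ p" by (simp only: int_dvd_int_iff)
    with p show False using prime_dvd_power by blast
  qed
  moreover have "f dvd F" by (rule fdvd[OF F])
  ultimately show ?thesis by (auto elim!: dvdE simp: hom_distribs)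
qed

text \<open>The exponent \<open>t\<close> is reached one prime factor at a time. Since
  \<open>z ^ p\<close> is again an \<open>m\<close>-th root of unity, \<open>z\<close> is
  generalized in the induction.\<close>

lemma root_of_unity_conjugate:
  fixes z :: complex
  assumes "z ^ m = 1" "m > 0" "coprime t m" "poly (of_int_poly F) z = 0"
  shows "poly (of_int_poly F) (z ^ t) = 0"
  using assms
proof (induction t arbitrary: z rule: prime_divisors_induct)
  case zero
  then show ?case by simp
next
  case (unit t)
  then show ?case by simp
next
  case (factor p t)
  have "\<not> p dvd m" using factor.hyps factor.prems(3)
    by (metis coprime_mult_left_iff coprime_absorb_left not_prime_unit)
  hence "poly (of_int_poly F) (z ^ p) = 0"
    using root_of_unity_conjugate_prime factor by blast
  moreover have "(z ^ p) ^ m = 1" using factor.prems(1) by (metis mult.commute power_mult power_one)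
  ultimately have "poly (of_int_poly F) ((z ^ p) ^ t) = 0"
    using factor by (intro factor.IH) auto
  thus ?case by (simp add: power_mult)
qed

section \<open>Minimal vanishing sums of roots of unity\<close>

text \<open>The index is an integer, so that conjugation becomes negation and equality becomes
  congruence modulo \<open>N\<close>.\<close>

definition unity_root :: "nat \<Rightarrow> int \<Rightarrow> complex" where
  "unity_root N x = cis (2 * of_int x * pi / of_nat N)"

lemma unity_root_nonzero [simp]: "unity_root N x \<noteq> 0"
  by (simp add: unity_root_def)

lemma unity_root_0 [simp]: "unity_root N 0 = 1"
  by (simp add: unity_root_def)

lemma unity_root_add: "unity_root N (x + y) = unity_root N x * unity_root N y"
  by (simp add: unity_root_def cis_mult add_divide_distrib algebra_simps)

lemma unity_root_minus: "unity_root N (- x) = cnj (unity_root N x)"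
  by (simp add: unity_root_def complex_eq_iff)

lemma unity_root_diff: "unity_root N (x - y) = unity_root N x / unity_root N y"
  by (simp add: unity_root_def cis_divide diff_divide_distrib algebra_simps)

lemma unity_root_pow: "unity_root N x ^ k = unity_root N (int k * x)"
  by (simp add: unity_root_def DeMoivre algebra_simps)

lemma unity_root_sum: "unity_root N (sum f A) = (\<Prod>x\<in>A. unity_root N (f x))"
  by (induction A rule: infinite_finite_induct) (auto simp: unity_root_add)

lemma unity_root_eq_1_iff:
  assumes "N > 0"
  shows "unity_root N x = 1 \<longleftrightarrow> int N dvd x"
proof
  assume "unity_root N x = 1"
  hence "cos (2 * of_int x * pi / of_nat N) = 1"
    unfolding unity_root_def by (metis cis.sel(1) one_complex.sel(1))
  then obtain y :: int where "2 * of_int x * pi / of_nat N = of_int y * 2 * pi"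
    by (auto simp: cos_one_2pi_int)
  hence "2 * pi * of_int x = 2 * pi * (of_int y * of_nat N)" using assms
    by (simp add: field_simps)
  hence "(of_int x :: real) = of_int y * of_nat N" by simp
  hence "x = y * int N" by (metis of_int_eq_iff of_int_mult of_int_of_nat_eq)
  thus "int N dvd x" by simp
next
  assume "int N dvd x"
  then obtain y where "x = int N * y" by blast
  hence "2 * of_int x * pi / of_nat N = 2 * pi * of_int y" using assms by (simp add: field_simps)
  thus "unity_root N x = 1" by (simp add: unity_root_def cis_multiple_2pi)
qed

lemma unity_root_eq_iff:
  assumes "N > 0"
  shows "unity_root N x = unity_root N y \<longleftrightarrow> int N dvd x - y"
  using unity_root_eq_1_iff[OF assms, of "x - y"] by (simp add: unity_root_diff)

lemma unity_root_power_eq_1: "N > 0 \<Longrightarrow> unity_root N x ^ N = 1"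
  by (simp add: unity_root_pow unity_root_eq_1_iff)

text \<open>Orthogonality of characters: the sum is geometric, and its ratio
  \<open>unity_root N k\<close> is an \<open>N\<close>-th root of unity.\<close>

lemma sum_unity_root:
  assumes "N > 0"
  shows "(\<Sum>x<N. unity_root N (int x * k)) = (if int N dvd k then of_nat N else 0)"
proof (cases "int N dvd k")
  case True
  then have "unity_root N (int x * k) = 1" for x by (simp add: unity_root_eq_1_iff[OF assms])
  with True show ?thesis by simp
next
  case False
  hence "unity_root N k \<noteq> 1" using unity_root_eq_1_iff[OF assms] by simp
  thus ?thesis using False unity_root_power_eq_1[OF assms, of k]
    by (simp add: geometric_sum flip: unity_root_pow)
qed

text \<open>Conjugating the relation by \<open>w \<mapsto> w ^ (1 + u * (m / p))\<close> multiplies the terms of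
  exponent class \<open>s\<close> by \<open>\<eta> ^ (u * s)\<close>, where \<open>\<eta>\<close> is a primitive \<open>p\<close>-th root of unity, so the
  classes can be separated by a finite Fourier transform. At most one \<open>u\<close> is not admissible, and it
  is dealt with by an empty class.\<close>
lemma exponent_class_sum_eq_0:
  fixes a :: "'i \<Rightarrow> int" and e :: "'i \<Rightarrow> nat"
  assumes "finite I" and m: "m > 0" and p: "prime p" "p dvd m"
    and w: "w = unity_root m 1"
    and rel: "(\<Sum>i\<in>I. of_int (a i) * w ^ e i) = 0"
    and cond: "p ^ 2 dvd m \<or> card I < p" and s: "s < p"
  shows "(\<Sum>i | i \<in> I \<and> e i mod p = s. of_int (a i) * w ^ e i) = 0"
proof -
  define M where "M = m div p"
  have mM: "m = M * p" using p by (simp add: M_def)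
  have p0: "p > 0" using prime_gt_0_nat[OF p(1)] .
  have wm: "w ^ m = 1" using m by (simp add: w unity_root_power_eq_1)
  define \<eta> where "\<eta> = w ^ M"
  have \<eta>: "\<eta> = unity_root p 1"
    using m by (simp add: \<eta>_def w unity_root_pow mM) (simp add: unity_root_def)
  define S where "S = (\<lambda>u. \<Sum>i\<in>I. of_int (a i) * w ^ e i * \<eta> ^ (u * e i))"
  define T where "T = (\<lambda>s. \<Sum>i | i \<in> I \<and> e i mod p = s. of_int (a i) * w ^ e i)"
  have S0: "S u = 0" if "coprime (1 + u * M) m" for u
  proof -
    \<comment> \<open>The relation becomes an integer polynomial vanishing at \<open>w\<close>, and
      conjugation evaluates it at a power of \<open>w\<close>.\<close>
    define F where "F = (\<Sum>i\<in>I. Polynomial.monom (a i) (e i))"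
    have F: "poly (of_int_poly F) y = (\<Sum>i\<in>I. of_int (a i) * y ^ e i)" for y :: complex
      by (simp add: F_def hom_distribs poly_sum poly_monom)
    have "poly (of_int_poly F) (w ^ (1 + u * M)) = 0"
      by (rule root_of_unity_conjugate[OF wm m that]) (simp add: F rel)
    moreover have "(w ^ (1 + u * M)) ^ k = w ^ k * \<eta> ^ (u * k)" for k
      unfolding \<eta>_def power_mult[symmetric] power_add[symmetric]
      by (simp add: algebra_simps)
    ultimately show ?thesis unfolding F S_def by (simp only: mult.assoc)
  qed
  \<comment> \<open>Fourier inversion over the classes modulo \<open>p\<close>. The exponent
    \<open>p - s\<close> replaces \<open>- s\<close> in the naturals, since
    \<open>\<eta> ^ p = 1\<close>.\<close>
  have T: "of_nat p * T s = (\<Sum>u<p. \<eta> ^ (u * (p - s)) * S u)" if "s < p" for s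
  proof -
    have "(\<Sum>u<p. \<eta> ^ (u * (p - s)) * S u)
       = (\<Sum>u<p. \<Sum>i\<in>I. of_int (a i) * w ^ e i * \<eta> ^ (u * (e i + (p - s))))"
      unfolding S_def sum_distrib_left
      by (intro sum.cong refl) (simp add: power_add algebra_simps)
    also have "\<dots> = (\<Sum>i\<in>I. of_int (a i) * w ^ e i * (\<Sum>u<p. (\<eta> ^ (e i + (p - s))) ^ u))"
      by (subst sum.swap) (simp add: sum_distrib_left mult.commute flip: power_mult)
    also have "\<dots> = (\<Sum>i\<in>I. of_int (a i) * w ^ e i * (if e i mod p = s then of_nat p else 0))"
    proof (intro sum.cong refl arg_cong2[where f = "(*)"])
      fix i
      have "(\<eta> ^ (e i + (p - s))) ^ u = unity_root p (int u * int (e i + (p - s)))" for u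
        unfolding \<eta> unity_root_pow by simp
      moreover have "int p dvd int (e i + (p - s)) \<longleftrightarrow> e i mod p = s"
      proof -
        have "int p dvd int (e i + (p - s)) \<longleftrightarrow> int p dvd (int (e i) - int s) + int p" using that
          by (simp add: of_nat_diff algebra_simps)
        also have "\<dots> \<longleftrightarrow> int p dvd (int (e i) - int s)" by simp
        also have "\<dots> \<longleftrightarrow> [e i = s] (mod p)" by (simp add: cong_int_iff flip: cong_iff_dvd_diff)
        finally show ?thesis using that by (simp add: cong_def)
      qed
      ultimately show "(\<Sum>u<p. (\<eta> ^ (e i + (p - s))) ^ u) = (if e i mod p = s then of_nat p else 0)"
        by (simp only: sum_unity_root[OF p0])
    qed
    also have "\<dots> = (\<Sum>i\<in>I. if e i mod p = s then of_nat p * (of_int (a i) * w ^ e i) else 0)"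
      by (intro sum.cong refl) simp
    also have "\<dots> = of_nat p * T s"
      unfolding T_def sum_distrib_left by (rule sum.inter_filter[OF \<open>finite I\<close>, symmetric])
    finally show ?thesis by simp
  qed
  \<comment> \<open>A common prime factor \<open>q\<close> of \<open>1 + u * M\<close> and
    \<open>m = M * p\<close> cannot divide \<open>M\<close>, as it would then divide 1; so it equals
    \<open>p\<close>.\<close>
  have bad: "p dvd 1 + u * M" if "\<not> coprime (1 + u * M) m" for u
  proof -
    have "gcd (1 + u * M) m \<noteq> 1" using that by (simp add: coprime_iff_gcd_eq_1)
    then obtain q where "prime q" "q dvd gcd (1 + u * M) m" using prime_factor_nat by blast
    hence q: "prime q" "q dvd 1 + u * M" "q dvd m" by simp_all
    have "\<not> q dvd M" using q(1,2)
      by (metis dvd_add_left_iff dvd_mult dvd_refl not_prime_unit)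
    hence "q dvd p" using q mM prime_dvd_mult_iff by blast
    hence "q = p" using q(1) p(1) primes_dvd_imp_eq by blast
    with q show ?thesis by simp
  qed
  have "T s = 0"
  proof (cases "\<exists>v<p. \<not> coprime (1 + v * M) m")
    case False
    hence "of_nat p * T s = 0" using T[OF s] S0 by simp
    then show ?thesis using p0 by simp
  next
    case True
    then obtain v where v: "v < p" "\<not> coprime (1 + v * M) m" by blast
    have pM: "\<not> p dvd M" using bad[OF v(2)] p(1)
      by (metis dvd_add_left_iff dvd_mult not_prime_unit)
    have uniq: "u = v" if u: "u < p" "\<not> coprime (1 + u * M) m" for u
    proof -
      have "[1 + u * M = 1 + v * M] (mod p)"
        using bad[OF u(2)] bad[OF v(2)] by (simp add: cong_def)
      hence "[u * M = v * M] (mod p)" by (metis cong_add_lcancel_nat)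
      hence "[u = v] (mod p)" using p pM
        by (metis cong_mult_rcancel_nat coprime_commute prime_imp_coprime)
      thus ?thesis using u v by (simp add: cong_def)
    qed
    \<comment> \<open>Only the term \<open>u = v\<close> survives, so every class sum is a nonzero
      multiple of the same number \<open>S v\<close>. The empty class \<open>r\<close> below shows
      that \<open>S v = 0\<close>.\<close>
    have T': "of_nat p * T s = \<eta> ^ (v * (p - s)) * S v" if "s < p" for s
    proof -
      have "(\<Sum>u<p. \<eta> ^ (u * (p - s)) * S u) = (\<Sum>u\<in>{v}. \<eta> ^ (u * (p - s)) * S u)"
      proof (intro sum.mono_neutral_right ballI)
        fix u assume u: "u \<in> {..<p} - {v}"
        hence "coprime (1 + u * M) m" using uniq by blast
        thus "\<eta> ^ (u * (p - s)) * S u = 0" by (simp only: S0 mult_zero_right)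
      qed (use v in auto)
      thus ?thesis using T[OF that] by simp
    qed
    have "\<not> p ^ 2 dvd m" using pM p0 by (simp add: mM power2_eq_square)
    with cond have "card I < p" by blast
    hence "card ((\<lambda>i. e i mod p) ` I) < card {..<p}"
      using card_image_le[OF \<open>finite I\<close>, of "\<lambda>i. e i mod p"] by simp
    hence "\<not> {..<p} \<subseteq> (\<lambda>i. e i mod p) ` I"
      using \<open>finite I\<close> by (meson card_mono finite_imageI linorder_not_less)
    then obtain r where r: "r < p" "\<And>i. i \<in> I \<Longrightarrow> e i mod p \<noteq> r" by blast
    have "T r = 0" unfolding T_def using r(2) by (intro sum.neutral) auto
    hence "S v = 0" using T'[OF r(1)] by (simp add: \<eta>)
    thus ?thesis using T'[OF s] p0 by simp
  qed
  thus ?thesis by (simp add: T_def)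
qed

text \<open>Let \<open>k\<close> be the least common exponent of the quotients. If a prime divisor
  \<open>p\<close> of \<open>k\<close> exceeds the number of terms or \<open>p ^ 2\<close> divides
  \<open>k\<close>, the terms with exponent divisible by \<open>p\<close> form a vanishing subsum.
  By minimality it is the whole sum, and \<open>k div p\<close> would be a smaller common exponent.
  So \<open>k\<close> is squarefree with prime factors at most \<open>card I\<close>.\<close>

theorem mann_minimal_vanishing_sum:
  fixes a :: "'i \<Rightarrow> int" and z :: "'i \<Rightarrow> complex"
  assumes "finite I" and m: "m > 0" "\<And>i. i \<in> I \<Longrightarrow> z i ^ m = 1"
    and rel: "(\<Sum>i\<in>I. of_int (a i) * z i) = 0"
    and minimal: "\<And>J. J \<subset> I \<Longrightarrow> J \<noteq> {} \<Longrightarrow> (\<Sum>i\<in>J. of_int (a i) * z i) \<noteq> 0"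
    and ij: "i \<in> I" "j \<in> I"
  shows "(z i / z j) ^ fact (card I) = 1"
proof -
  define P where "P = (\<lambda>n. n > 0 \<and> (\<forall>i\<in>I. (z i / z j) ^ n = 1))"
  define k where "k = (LEAST n. P n)"
  have zj: "z j \<noteq> 0" using m(2)[OF ij(2)] m(1) by (auto simp: power_0_left)
  have "P m" using m ij zj by (simp add: P_def power_divide)
  hence Pk: "P k" unfolding k_def by (rule LeastI)
  hence k0: "k > 0" by (simp add: P_def)
  define w where "w = unity_root k 1"
  have "\<exists>e. y = w ^ e" if "y ^ k = 1" for y
  proof -
    have "y \<in> (\<lambda>l. cis (2 * pi * real l / real k)) ` {..<k}"
      using bij_betw_roots_unity[OF k0] that by (auto simp: bij_betw_def)
    moreover have "w ^ l = cis (2 * pi * real l / real k)" for l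
      by (simp add: w_def unity_root_pow) (simp add: unity_root_def ac_simps)
    ultimately show ?thesis by auto
  qed
  hence "\<forall>i\<in>I. \<exists>e. z i / z j = w ^ e" using Pk by (simp add: P_def)
  hence "\<exists>e. \<forall>i\<in>I. z i / z j = w ^ e i" by (rule bchoice)
  then obtain e0 where e0: "\<And>i. i \<in> I \<Longrightarrow> z i / z j = w ^ e0 i" by blast
  \<comment> \<open>Giving the term \<open>j\<close> the exponent 0 puts it into the class of
    residue 0 for every \<open>p\<close>, so this class is never empty.\<close>
  define e where "e = e0(j := 0)"
  have e: "z i / z j = w ^ e i" if "i \<in> I" for i
    using e0[OF that] zj by (cases "i = j") (simp_all add: e_def)
  have sum_eq: "(\<Sum>i\<in>J. of_int (a i) * w ^ e i) = (\<Sum>i\<in>J. of_int (a i) * z i) / z j"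
    if "J \<subseteq> I" for J
    unfolding sum_divide_distrib using that e by (intro sum.cong refl) (auto simp flip: e)
  have sieve: "\<not> (p ^ 2 dvd k \<or> card I < p)" if p: "prime p" "p dvd k" for p
  proof
    assume c: "p ^ 2 dvd k \<or> card I < p"
    have p0: "p > 0" using prime_gt_0_nat[OF p(1)] .
    define J where "J = {i. i \<in> I \<and> e i mod p = 0}"
    have "(\<Sum>i\<in>J. of_int (a i) * w ^ e i) = 0"
      unfolding J_def
      by (rule exponent_class_sum_eq_0[OF \<open>finite I\<close> k0 p w_def _ c p0])
         (simp add: sum_eq rel)
    hence "(\<Sum>i\<in>J. of_int (a i) * z i) = 0" using sum_eq[of J] zj by (auto simp: J_def)
    moreover have "J \<subseteq> I" "j \<in> J" using ij by (auto simp: J_def e_def)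
    ultimately have "J = I" using minimal[of J] by blast
    have "(z i / z j) ^ (k div p) = 1" if "i \<in> I" for i
    proof -
      have "e i mod p = 0" using that \<open>J = I\<close> by (auto simp: J_def)
      then obtain l where l: "e i = p * l" by blast
      have "(z i / z j) ^ (k div p) = (w ^ k) ^ l"
        unfolding e[OF that] l using p by (auto simp flip: power_mult elim!: dvdE simp: ac_simps)
      also have "w ^ k = 1" using k0 by (simp add: w_def unity_root_power_eq_1)
      finally show ?thesis by simp
    qed
    hence "P (k div p)" using p k0 by (auto simp: P_def dvd_imp_le div_greater_zero_iff)
    hence "k \<le> k div p" unfolding k_def by (rule Least_le)
    moreover have "k div p < k" using prime_gt_1_nat[OF p(1)] k0 by simp
    ultimately show False by simp
  qed
  have "k dvd fact (card I)"
  proof (rule multiplicity_le_imp_dvd)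
    fix p :: nat assume p: "prime p"
    show "multiplicity p k \<le> multiplicity p (fact (card I))"
    proof (cases "p dvd k")
      case True
      have "multiplicity p k < 2" using sieve[OF p True] k0 p
        by (intro multiplicity_lessI) (auto simp: not_prime_unit)
      moreover have "p dvd fact (card I)" using sieve[OF p True] p by (simp add: prime_dvd_fact_iff)
      hence "multiplicity p (fact (card I) :: nat) \<ge> 1" using p
        by (intro multiplicity_geI) auto
      ultimately show ?thesis by simp
    qed (simp add: not_dvd_imp_multiplicity_0)
  qed (use k0 in auto)
  then obtain l where "fact (card I) = k * l" by blast
  thus ?thesis using Pk ij by (simp add: P_def power_mult)
qed

text \<open>A zero-sum subset containing \<open>i\<close> of least cardinality works: if a proper
  nonempty part \<open>K\<close> had sum 0, so would \<open>J - K\<close>, and one of these smaller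
  sets contains \<open>i\<close>.\<close>

lemma minimal_vanishing_subset:
  fixes f :: "'i \<Rightarrow> 'b::comm_ring_1"
  assumes "finite I" "sum f I = 0" "i \<in> I"
  obtains J where "J \<subseteq> I" "i \<in> J" "sum f J = 0" "\<And>K. K \<subset> J \<Longrightarrow> K \<noteq> {} \<Longrightarrow> sum f K \<noteq> 0"
proof -
  define P where "P = (\<lambda>J. J \<subseteq> I \<and> i \<in> J \<and> sum f J = 0)"
  have "P I" using assms by (simp add: P_def)
  then obtain J where J: "P J" "\<And>K. P K \<Longrightarrow> card J \<le> card K"
    by (metis exists_least_iff[of "\<lambda>n. \<exists>J. P J \<and> card J = n"] linorder_not_less)
  have fin: "finite J" using J(1) assms(1) finite_subset by (auto simp: P_def)
  have "sum f K \<noteq> 0" if K: "K \<subset> J" "K \<noteq> {}" for K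
  proof
    assume s: "sum f K = 0"
    have s': "sum f (J - K) = 0"
      using J(1) K s fin by (simp add: P_def sum_diff psubset_imp_subset)
    have "P K \<or> P (J - K)" using J(1) K s s' by (auto simp: P_def)
    moreover have "card K < card J" using K fin by (simp add: psubset_card_mono)
    moreover have "card (J - K) < card J" using K fin by (intro psubset_card_mono) auto
    ultimately show False using J(2) by (meson linorder_not_less)
  qed
  with J(1) that show thesis by (auto simp: P_def)
qed

section \<open>Multiplicity at the edges of the spectrum\<close>

lemma card_le_power_if_PiE:
  assumes "\<And>k. k \<in> S \<Longrightarrow> k \<in> {1..d::nat} \<rightarrow>\<^sub>E A" "finite A"
  shows "card S \<le> card A ^ d"
proof -
  have "card S \<le> card ({1..d} \<rightarrow>\<^sub>E A)"
    using assms by (intro card_mono finite_PiE) auto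
  also have "\<dots> = card A ^ d" by (simp add: card_PiE)
  finally show ?thesis .
qed

lemma carrier_torus_group:
  assumes "N > 0"
  shows "carrier (torus_group d N) = {1..d} \<rightarrow>\<^sub>E {0..<int N}"
  using assms by (simp add: torus_group_def carrier_product_group carrier_integer_mod_group)

lemma torus_multiplicity_le:
  assumes "N > 0"
  shows "torus_multiplicity d N \<mu> \<le> N ^ d"
proof -
  have "torus_multiplicity d N \<mu> \<le> card {0..<int N} ^ d"
    unfolding torus_multiplicity_def using carrier_torus_group[OF assms]
    by (intro card_le_power_if_PiE) auto
  thus ?thesis by simp
qed

text \<open>The other \<open>d - 1\<close> terms contribute at most \<open>d - 1\<close>. This is
  what forces a common sign on the cosines at an edge of the spectrum.\<close>

lemma cos_pos_if_sum_large:
  fixes c :: "nat \<Rightarrow> real"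
  assumes "\<And>j. j \<in> {1..d} \<Longrightarrow> c j \<le> 1" "(\<Sum>j=1..d. c j) > real d - 1" "j \<in> {1..d}"
  shows "c j > 0"
proof -
  have "(\<Sum>j=1..d. c j) = c j + (\<Sum>i\<in>{1..d}-{j}. c i)"
    using assms(3) by (simp add: sum.remove)
  also have "(\<Sum>i\<in>{1..d}-{j}. c i) \<le> (\<Sum>i\<in>{1..d}-{j}. 1)"
    using assms(1) by (intro sum_mono) auto
  also have "\<dots> = real d - 1" using assms(3) by (simp add: of_nat_diff)
  finally show ?thesis using assms(2) by simp
qed

lemma inj_on_unity_root:
  assumes "N > 0"
  shows "inj_on (unity_root N) {0..<int N}"
proof (rule inj_onI, rule ccontr)
  fix x y assume xy: "x \<in> {0..<int N}" "y \<in> {0..<int N}" "unity_root N x = unity_root N y" "x \<noteq> y"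
  have "int N dvd x - y" using xy(3) unity_root_eq_iff[OF assms] by blast
  hence "\<bar>int N\<bar> \<le> \<bar>x - y\<bar>" using xy(4) by (intro dvd_imp_le_int) auto
  thus False using xy by auto
qed

text \<open>In the proof, the terms of the relation \<open>\<mu>(k) - \<mu>(l) = 0\<close> are indexed by triples \<open>(b, j, s)\<close>:
  \<open>b\<close> selects the tuple \<open>k\<close> or \<open>l\<close>, and the sign \<open>s\<close> selects one of the two conjugate roots of
  unity in the cosine of coordinate \<open>j\<close>.\<close>
lemma coordinate_near_reference:
  fixes k l :: "nat \<Rightarrow> int"
  assumes N: "N > 0" and eq: "torus_mu d N k = torus_mu d N l"
    and \<sigma>: "\<sigma> = 1 \<or> \<sigma> = -1" and large: "\<sigma> * torus_mu d N l > 2 * real d - 2"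
    and i: "i \<in> {1..d}"
  shows "\<exists>j\<in>{1..d}. \<exists>s\<in>{1, -1}. (unity_root N (l i) / unity_root N (s * k j)) ^ fact (4 * d) = 1"
proof -
  define I :: "(bool \<times> nat \<times> int) set" where "I = UNIV \<times> {1..d} \<times> {1, -1}"
  define a :: "bool \<times> nat \<times> int \<Rightarrow> int" where "a = (\<lambda>(b, j, s). if b then 1 else -1)"
  define z where "z = (\<lambda>(b, j, s). unity_root N (s * (if b then k j else l j)))"
  have fin: "finite I" by (simp add: I_def)
  have cardI: "card I = 4 * d" by (simp add: I_def card_cartesian_product)
  have pair: "unity_root N x + unity_root N (- x) = of_real (2 * cos (2 * of_int x * pi / of_nat N))"
    for x by (simp add: unity_root_def complex_eq_iff)
  have mu: "(\<Sum>j=1..d. \<Sum>s\<in>{1,-1}. unity_root N (s * f j)) = of_real (torus_mu d N f)" for f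
    by (simp add: torus_mu_def pair sum_distrib_left)
  have "(\<Sum>x\<in>I. of_int (a x) * z x)
      = (\<Sum>b\<in>UNIV. \<Sum>j=1..d. \<Sum>s\<in>{1,-1}. of_int (a (b,j,s)) * z (b,j,s))"
    by (simp only: I_def sum.cartesian_product')
  also have "\<dots> = (\<Sum>j=1..d. \<Sum>s\<in>{1,-1}. unity_root N (s * k j))
                - (\<Sum>j=1..d. \<Sum>s\<in>{1,-1}. unity_root N (s * l j))"
    by (simp add: UNIV_bool a_def z_def sum_negf sum.distrib)
  also have "\<dots> = 0" unfolding mu by (simp add: eq)
  finally have sum0: "(\<Sum>x\<in>I. of_int (a x) * z x) = 0" .
  \<comment> \<open>One of the two terms of \<open>l\<close> at coordinate \<open>i\<close>; the
    minimal subsum through it is compared with \<open>k\<close>.\<close>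
  have iI: "(False, i, 1) \<in> I" using i by (simp add: I_def)
  obtain J where J: "J \<subseteq> I" "(False, i, 1) \<in> J" "(\<Sum>x\<in>J. of_int (a x) * z x) = 0"
    "\<And>K. K \<subset> J \<Longrightarrow> K \<noteq> {} \<Longrightarrow> (\<Sum>x\<in>K. of_int (a x) * z x) \<noteq> 0"
    using minimal_vanishing_subset[OF fin sum0 iI] by blast
  have finJ: "finite J" using J(1) fin finite_subset by blast
  have pos: "\<sigma> * cos (2 * of_int (l j) * pi / of_nat N) > 0" if "j \<in> {1..d}" for j
  proof (rule cos_pos_if_sum_large[OF _ _ that])
    show "\<sigma> * cos (2 * of_int (l j) * pi / of_nat N) \<le> 1" for j
      using \<sigma> cos_ge_minus_one[of "2 * of_int (l j) * pi / of_nat N"] by auto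
    show "real d - 1 < (\<Sum>j=1..d. \<sigma> * cos (2 * of_int (l j) * pi / of_nat N))"
      using large by (simp add: torus_mu_def flip: sum_distrib_left)
  qed
  have "\<exists>x\<in>J. fst x"
  proof (rule ccontr)
    assume no: "\<not> (\<exists>x\<in>J. fst x)"
    have "0 < (\<Sum>x\<in>J. \<sigma> * Re (z x))"
    proof (rule sum_pos)
      show "J \<noteq> {}" using J(2) by blast
      fix x assume x: "x \<in> J"
      obtain j s where xj: "x = (False, j, s)" using no x by (metis eq_fst_iff)
      have js: "j \<in> {1..d}" "s = 1 \<or> s = -1" using x J(1) by (auto simp: xj I_def)
      have "Re (z x) = cos (2 * of_int (l j) * pi / of_nat N)"
        using js(2) by (auto simp: xj z_def unity_root_def)
      thus "0 < \<sigma> * Re (z x)" using pos[OF js(1)] by simp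
    qed (rule finJ)
    \<comment> \<open>All indices here have first component \<open>False\<close>, hence coefficient
      -1, which accounts for the minus sign.\<close>
    also have "(\<Sum>x\<in>J. \<sigma> * Re (z x)) = - \<sigma> * Re (\<Sum>x\<in>J. of_int (a x) * z x)"
      unfolding Re_sum sum_distrib_left using no
      by (intro sum.cong refl) (auto simp: a_def split: prod.splits)
    finally show False using J(3) by simp
  qed
  then obtain j s where js: "(True, j, s) \<in> J" by auto
  \<comment> \<open>Mann's theorem gives an exponent depending on \<open>J\<close>; enlarging it to
    \<open>fact (4 * d)\<close> makes it uniform.\<close>
  have "card J \<le> 4 * d" using card_mono[OF fin J(1)] cardI by simp
  hence "fact (card J) dvd (fact (4 * d) :: nat)" by (rule fact_dvd)
  then obtain c where c: "fact (4 * d) = fact (card J) * (c :: nat)" by blast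
  have "(z (False, i, 1) / z (True, j, s)) ^ fact (card J) = 1"
    by (rule mann_minimal_vanishing_sum[OF finJ N _ J(3) J(4) J(2) js])
       (auto simp: z_def unity_root_power_eq_1[OF N] split: prod.splits)
  hence "(unity_root N (l i) / unity_root N (s * k j)) ^ fact (4 * d) = 1"
    by (simp add: z_def c power_mult)
  moreover have "j \<in> {1..d}" "s \<in> {1, -1}" using js J(1) by (auto simp: I_def)
  ultimately show ?thesis by blast
qed

text \<open>One reference tuple \<open>k\<close> leaves each coordinate of \<open>l\<close> at most
  \<open>2 * d\<close> choices of \<open>(j, s)\<close> and, for each of them, at most
  \<open>fact (4 * d)\<close> quotients. The sign \<sigma> treats both edges at once.\<close>

lemma torus_multiplicity_edge_le:
  assumes N: "N > 0" and \<sigma>: "\<sigma> = 1 \<or> \<sigma> = -1" and large: "\<sigma> * \<mu> > 2 * real d - 2"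
  shows "torus_multiplicity d N \<mu> \<le> (2 * d * fact (4 * d)) ^ d"
proof (cases "\<exists>k \<in> carrier (torus_group d N). torus_mu d N k = \<mu>")
  case False
  then have "{k \<in> carrier (torus_group d N). torus_mu d N k = \<mu>} = {}" by blast
  then show ?thesis by (metis card.empty le0 torus_multiplicity_def)
next
  case True
  then obtain k where k: "torus_mu d N k = \<mu>" by blast
  define F :: nat where "F = fact (4 * d)"
  define B where "B = (\<lambda>y. {x \<in> {0..<int N}. (unity_root N x / unity_root N y) ^ F = 1})"
  define A where "A = (\<Union>(j, s) \<in> {1..d} \<times> {1, -1}. B (s * k j))"
  have "card (B y) \<le> F" for y
  proof -
    have "card (B y) = card ((\<lambda>x. unity_root N x / unity_root N y) ` B y)"
    proof (rule card_image[symmetric], rule inj_onI)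
      fix x x' assume xx: "x \<in> B y" "x' \<in> B y"
        and "unity_root N x / unity_root N y = unity_root N x' / unity_root N y"
      hence "unity_root N x = unity_root N x'" by simp
      thus "x = x'" using inj_on_unity_root[OF N] xx unfolding B_def by (blast dest: inj_onD)
    qed
    also have "\<dots> \<le> card {w :: complex. w ^ F = 1}"
      by (intro card_mono finite_roots_unity) (auto simp: B_def F_def)
    also have "\<dots> \<le> F" by (intro card_roots_unity) (simp add: F_def Suc_le_eq)
    finally show ?thesis .
  qed
  note card_B = this
  have "card A \<le> (\<Sum>x\<in>{1..d} \<times> {1, - 1}. card (case x of (j, s) \<Rightarrow> B (s * k j)))"
    unfolding A_def by (rule card_UN_le) simp
  also have "\<dots> \<le> (\<Sum>x\<in>{1..d} \<times> {1, - 1 :: int}. F)"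
    by (intro sum_mono) (simp add: card_B split: prod.split)
  also have "\<dots> = 2 * d * F" by (simp add: card_cartesian_product)
  finally have cardA: "card A \<le> 2 * d * F" .
  have "B y \<subseteq> {0..<int N}" for y by (auto simp: B_def)
  hence "A \<subseteq> {0..<int N}" by (auto simp: A_def)
  hence finA: "finite A" by (rule finite_subset) simp
  have "torus_multiplicity d N \<mu> \<le> card A ^ d"
    unfolding torus_multiplicity_def
  proof (rule card_le_power_if_PiE)
    fix l assume l: "l \<in> {k \<in> carrier (torus_group d N). torus_mu d N k = \<mu>}"
    hence lc: "l \<in> {1..d} \<rightarrow>\<^sub>E {0..<int N}" by (simp add: carrier_torus_group[OF N])
    have "l i \<in> A" if i: "i \<in> {1..d}" for i
    proof -
      have "torus_mu d N k = torus_mu d N l" "\<sigma> * torus_mu d N l > 2 * real d - 2"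
        using l k large by auto
      from coordinate_near_reference[OF N this(1) \<sigma> this(2) i]
      obtain j s where "j \<in> {1..d}" "s \<in> {1, -1}"
        "(unity_root N (l i) / unity_root N (s * k j)) ^ F = 1"
        unfolding F_def by blast
      moreover have "l i \<in> {0..<int N}" using lc i by blast
      ultimately show ?thesis by (auto simp: A_def B_def)
    qed
    with lc show "l \<in> {1..d} \<rightarrow>\<^sub>E A" by (auto simp: PiE_iff)
  qed (rule finA)
  also have "\<dots> \<le> (2 * d * F) ^ d" using cardA by (rule power_mono) simp
  finally show ?thesis by (simp add: F_def)
qed

section \<open>The spectrum of the discrete torus\<close>

text \<open>The Hartley kernel \<open>cas \<theta> = cos \<theta> + sin \<theta>\<close>: the eigenvectors obtained from it are real
  and their matrix is, up to scaling, its own inverse.\<close>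
definition cas :: "complex \<Rightarrow> real" where
  "cas z = Re z + Im z"

lemma cas_mult_cas: "cas x * cas y = Re (x * cnj y) + Im (x * y)"
  by (simp add: cas_def algebra_simps)

lemma cas_mult_add_cnj: "cas (x * y) + cas (x * cnj y) = 2 * Re y * cas x"
  by (simp add: cas_def algebra_simps)

definition dot :: "nat \<Rightarrow> (nat \<Rightarrow> int) \<Rightarrow> (nat \<Rightarrow> int) \<Rightarrow> int" where
  "dot d u v = (\<Sum>j=1..d. u j * v j)"

lemma finite_carrier_torus_group: "N > 0 \<Longrightarrow> finite (carrier (torus_group d N))"
  by (simp add: carrier_torus_group finite_PiE)

lemma card_carrier_torus_group: "N > 0 \<Longrightarrow> card (carrier (torus_group d N)) = N ^ d"
  by (simp add: carrier_torus_group card_PiE)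

lemma sum_unity_root_dot:
  assumes "N > 0"
  shows "(\<Sum>w\<in>carrier (torus_group d N). unity_root N (dot d u w))
    = (if \<forall>j\<in>{1..d}. int N dvd u j then of_nat (N ^ d) else 0)"
proof -
  have 1: "(\<Sum>y\<in>{0..<int N}. unity_root N (u j * y)) = (if int N dvd u j then of_nat N else 0)" for j
  proof -
    have "(\<Sum>y\<in>{0..<int N}. unity_root N (u j * y)) = (\<Sum>y\<in>int ` {..<N}. unity_root N (u j * y))"
      by (simp add: image_int_atLeastLessThan lessThan_atLeast0)
    also have "\<dots> = (\<Sum>x<N. unity_root N (int x * u j))"
      by (subst sum.reindex) (simp_all add: mult.commute)
    finally show ?thesis by (simp add: sum_unity_root[OF assms])
  qed
  have "(\<Sum>w\<in>carrier (torus_group d N). unity_root N (dot d u w))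
      = (\<Prod>j\<in>{1..d}. \<Sum>y\<in>{0..<int N}. unity_root N (u j * y))"
    by (simp add: carrier_torus_group[OF assms] dot_def unity_root_sum prod_sum_PiE)
  also have "\<dots> = (\<Prod>j\<in>{1..d}. if int N dvd u j then of_nat N else 0)" unfolding 1 ..
  also have "\<dots> = (if \<forall>j\<in>{1..d}. int N dvd u j then of_nat (N ^ d) else 0)"
    by auto
  finally show ?thesis .
qed

definition hartley :: "nat \<Rightarrow> nat \<Rightarrow> (nat \<Rightarrow> int) \<Rightarrow> (nat \<Rightarrow> int) \<Rightarrow> real" where
  "hartley d N u v = cas (unity_root N (dot d u v))"

text \<open>\<open>cas_mult_cas\<close> splits the product into a real part at \<open>u - v\<close>
  and an imaginary part at \<open>u + v\<close>. Both character sums are real, so only the first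
  contributes, and it detects \<open>u = v\<close>.\<close>

lemma hartley_orthogonal:
  assumes N: "N > 0" and u: "u \<in> carrier (torus_group d N)" and v: "v \<in> carrier (torus_group d N)"
  shows "(\<Sum>w\<in>carrier (torus_group d N). hartley d N u w * hartley d N w v)
    = (if u = v then real (N ^ d) else 0)"
proof -
  let ?V = "carrier (torus_group d N)"
  have dvd_iff: "(\<forall>j\<in>{1..d}. int N dvd u j - v j) \<longleftrightarrow> u = v"
  proof
    assume *: "\<forall>j\<in>{1..d}. int N dvd u j - v j"
    have uv: "u \<in> {1..d} \<rightarrow>\<^sub>E {0..<int N}" "v \<in> {1..d} \<rightarrow>\<^sub>E {0..<int N}"
      using u v by (auto simp: carrier_torus_group[OF N])
    show "u = v"
    proof (rule PiE_ext[OF uv])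
      fix j assume j: "j \<in> {1..d}"
      have "unity_root N (u j) = unity_root N (v j)" using * j unity_root_eq_iff[OF N] by blast
      thus "u j = v j" using inj_on_unity_root[OF N] PiE_mem[OF uv(1) j] PiE_mem[OF uv(2) j]
        by (auto dest: inj_onD)
    qed
  qed simp
  have "hartley d N u w * hartley d N w v
      = Re (unity_root N (dot d (\<lambda>j. u j - v j) w)) + Im (unity_root N (dot d (\<lambda>j. u j + v j) w))" for w
  proof -
    have "dot d (\<lambda>j. u j - v j) w = dot d u w + - dot d w v"
      "dot d (\<lambda>j. u j + v j) w = dot d u w + dot d w v"
      by (simp_all add: dot_def sum_subtractf sum.distrib algebra_simps)
    thus ?thesis by (simp only: hartley_def cas_mult_cas unity_root_add unity_root_minus)
  qed
  hence "(\<Sum>w\<in>?V. hartley d N u w * hartley d N w v)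
    = Re (\<Sum>w\<in>?V. unity_root N (dot d (\<lambda>j. u j - v j) w))
      + Im (\<Sum>w\<in>?V. unity_root N (dot d (\<lambda>j. u j + v j) w))"
    by (simp add: sum.distrib)
  thus ?thesis unfolding sum_unity_root_dot[OF N] by (simp only: dvd_iff) simp
qed

definition torus_step :: "nat \<Rightarrow> nat \<Rightarrow> (nat \<Rightarrow> int) \<Rightarrow> nat \<Rightarrow> int \<Rightarrow> nat \<Rightarrow> int" where
  "torus_step d N u i s = (\<lambda>j\<in>{1..d}. if j = i then (u j + s) mod int N else u j)"

lemma torus_neighbours:
  assumes N: "N \<ge> 3" and u: "u \<in> carrier (torus_group d N)"
  shows "{v. cayley_adj (torus_group d N) (torus_generators d N) u v}
    = (\<lambda>(i, s). torus_step d N u i s) ` ({1..d} \<times> {1, -1})"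
proof -
  have N0: "N > 0" using N by simp
  have uP: "u \<in> {1..d} \<rightarrow>\<^sub>E {0..<int N}" using u by (simp add: carrier_torus_group[OF N0])
  have step_in: "torus_step d N u i s \<in> carrier (torus_group d N)" for i s
    using uP N0 by (auto simp: carrier_torus_group[OF N0] torus_step_def)
  have mod_u: "u j mod int N = u j" if "j \<in> {1..d}" for j
    using PiE_mem[OF uP that] by simp
  have plus: "u \<otimes>\<^bsub>torus_group d N\<^esub> basis_vec d i = torus_step d N u i 1" for i
    using mod_u by (auto simp: torus_group_def basis_vec_def torus_step_def)
  have "basis_vec d i \<in> {1..d} \<rightarrow>\<^sub>E carrier (integer_mod_group N)" for i
    using N by (auto simp: basis_vec_def)
  hence "inv\<^bsub>torus_group d N\<^esub> (basis_vec d i) = (\<lambda>j\<in>{1..d}. (if j = i then -1 else 0) mod int N)" for i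
    using N by (auto simp: torus_group_def basis_vec_def inv_product_group)
  hence minus: "u \<otimes>\<^bsub>torus_group d N\<^esub> inv\<^bsub>torus_group d N\<^esub> (basis_vec d i) = torus_step d N u i (-1)" for i
    using mod_u by (auto simp: torus_group_def torus_step_def mod_add_right_eq mod_diff_right_eq)
  have "cayley_adj (torus_group d N) (torus_generators d N) u v
      \<longleftrightarrow> (\<exists>i\<in>{1..d}. v = torus_step d N u i 1 \<or> v = torus_step d N u i (-1))" for v
    unfolding cayley_adj_def torus_generators_def using u step_in plus minus by auto
  thus ?thesis by auto
qed

text \<open>Here \<open>N \<ge> 3\<close> matters: \<open>N\<close> divides neither 1 nor 2, so a
  step changes its coordinate, and the steps by 1 and -1 differ. Neighbour sums thus have
  \<open>2 * d\<close> distinct terms.\<close>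

lemma inj_on_torus_step:
  assumes N: "N \<ge> 3" and u: "u \<in> carrier (torus_group d N)"
  shows "inj_on (\<lambda>(i, s). torus_step d N u i s) ({1..d} \<times> {1, -1})"
proof (rule inj_onI, clarify)
  fix i i' s s' assume i: "i \<in> {1..d}" "i' \<in> {1..d}" and s: "s \<in> {1, -1}" "s' \<in> {1, -1}"
    and eq: "torus_step d N u i s = torus_step d N u i' s'"
  have uP: "u \<in> {1..d} \<rightarrow>\<^sub>E {0..<int N}" using u N by (simp add: carrier_torus_group)
  have not_dvd: "\<not> int N dvd x" if "x \<noteq> 0" "\<bar>x\<bar> < 3" for x
    using that N dvd_imp_le_int[of x "int N"] by auto
  have eq_i: "torus_step d N u i s i = torus_step d N u i' s' i" using eq by simp
  have ne: "(u i + s) mod int N \<noteq> u i"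
  proof
    assume "(u i + s) mod int N = u i"
    hence "[u i + s = u i] (mod int N)" using PiE_mem[OF uP i(1)] by (simp add: cong_def)
    hence "int N dvd s" by (simp add: cong_iff_dvd_diff)
    with not_dvd[of s] s show False by auto
  qed
  have ii: "i = i'" using eq_i ne i by (auto simp: torus_step_def split: if_splits)
  hence "[u i + s = u i + s'] (mod int N)" using eq_i i by (simp add: torus_step_def cong_def)
  hence "int N dvd s - s'" by (simp add: cong_iff_dvd_diff)
  with not_dvd[of "s - s'"] s have "s = s'" by auto
  with ii show "i = i' \<and> s = s'" by simp
qed

text \<open>Reduction modulo \<open>N\<close> is invisible to \<open>unity_root\<close>, so a step
  only adds \<open>s * k i\<close> to its index.\<close>

lemma hartley_torus_step:
  assumes N: "N > 0" and i: "i \<in> {1..d}"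
  shows "hartley d N (torus_step d N u i s) k = cas (unity_root N (dot d u k) * unity_root N (s * k i))"
proof -
  have "dot d (torus_step d N u i s) k - (dot d u k + s * k i)
     = (\<Sum>j=1..d. (torus_step d N u i s j - u j - (if j = i then s else 0)) * k j)"
    using i by (simp add: dot_def left_diff_distrib sum_subtractf if_distrib[of "\<lambda>x. x * _"] cong: if_cong)
  moreover have "int N dvd \<dots>"
  proof (rule dvd_sum, rule dvd_mult2)
    fix j assume "j \<in> {1..d}"
    moreover have "int N dvd (u i + s) mod int N - (u i + s)"
      by (metis mod_mod_trivial mod_eq_dvd_iff)
    ultimately show "int N dvd torus_step d N u i s j - u j - (if j = i then s else 0)"
      by (auto simp: torus_step_def algebra_simps)
  qed
  ultimately have "unity_root N (dot d (torus_step d N u i s) k) = unity_root N (dot d u k + s * k i)"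
    by (simp add: unity_root_eq_iff[OF N])
  thus ?thesis by (simp add: hartley_def unity_root_add)
qed

text \<open>The two opposite steps in each direction combine through
  \<open>cas_mult_add_cnj\<close>.\<close>

lemma hartley_eigenvector:
  assumes N: "N \<ge> 3" and u: "u \<in> carrier (torus_group d N)"
  shows "(\<Sum>v | cayley_adj (torus_group d N) (torus_generators d N) u v. hartley d N v k)
    = torus_mu d N k * hartley d N u k"
proof -
  let ?z = "unity_root N (dot d u k)"
  have "(\<Sum>v | cayley_adj (torus_group d N) (torus_generators d N) u v. hartley d N v k)
     = (\<Sum>(i, s)\<in>{1..d} \<times> {1, -1}. hartley d N (torus_step d N u i s) k)"
    unfolding torus_neighbours[OF assms]
    by (subst sum.reindex[OF inj_on_torus_step[OF assms]]) (simp add: case_prod_unfold comp_def)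
  also have "\<dots> = (\<Sum>i=1..d. \<Sum>s\<in>{1, -1}. hartley d N (torus_step d N u i s) k)"
    by (simp only: sum.cartesian_product)
  also have "\<dots> = (\<Sum>i=1..d. 2 * Re (unity_root N (k i)) * cas ?z)"
  proof (intro sum.cong refl)
    fix i assume "i \<in> {1..d}"
    hence "(\<Sum>s\<in>{1, -1}. hartley d N (torus_step d N u i s) k)
        = cas (?z * unity_root N (k i)) + cas (?z * cnj (unity_root N (k i)))"
      using N by (simp add: hartley_torus_step unity_root_minus)
    thus "(\<Sum>s\<in>{1, -1}. hartley d N (torus_step d N u i s) k) = 2 * Re (unity_root N (k i)) * cas ?z"
      by (simp only: cas_mult_add_cnj)
  qed
  also have "\<dots> = torus_mu d N k * hartley d N u k"
    by (simp add: torus_mu_def hartley_def unity_root_def sum_distrib_left sum_distrib_right)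
  finally show ?thesis .
qed

lemma proots_prod_linear_factors:
  fixes xs :: "'a::idom list"
  shows "proots (\<Prod>a\<leftarrow>xs. [:- a, 1:]) = mset xs"
proof (induction xs)
  case (Cons a xs)
  have "(\<Prod>a\<leftarrow>xs. [:- a, 1:]) \<noteq> 0" by (auto simp: prod_list_zero_iff)
  with Cons show ?case by (simp add: proots_mult del: mult_pCons_left)
qed simp

text \<open>The matrix \<open>H\<close> of the Hartley kernel satisfies \<open>H * H = n\<close>
  times the identity, hence it is invertible and diagonalizes the adjacency matrix over the reals.
  The diagonal form also yields the algebraic multiplicities.\<close>

lemma proots_char_poly_torus:
  assumes N: "N \<ge> 3"
  shows "proots (char_poly (torus_adjacency_matrix d N))
    = image_mset (torus_mu d N) (mset_set (carrier (torus_group d N)))"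
proof -
  define V where "V = carrier (torus_group d N)"
  define E where "E = cayley_adj (torus_group d N) (torus_generators d N)"
  define n where "n = card V"
  define g where "g = from_nat_into V"
  have N0: "N > 0" using N by simp
  have finV: "finite V" using finite_carrier_torus_group[OF N0] by (simp add: V_def)
  have n: "n = N ^ d" using card_carrier_torus_group[OF N0] by (simp add: n_def V_def)
  have n0: "real n \<noteq> 0" using N0 by (simp add: n)
  have g: "bij_betw g {0..<n} V" using bij_betw_from_nat_into_finite[OF finV]
    by (simp add: g_def n_def lessThan_atLeast0)
  have gV: "g i \<in> V" if "i < n" for i using g that by (auto simp: bij_betw_def)
  have g_inj: "g i = g j \<longleftrightarrow> i = j" if "i < n" "j < n" for i j
    using g that by (auto simp: bij_betw_def dest: inj_onD)
  have sum_g: "(\<Sum>i\<in>{0..<n}. f (g i)) = (\<Sum>v\<in>V. f v)" for f :: "_ \<Rightarrow> real"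
    by (rule sum.reindex_bij_betw[OF g])
  define A where "A = torus_adjacency_matrix d N"
  define H where "H = mat n n (\<lambda>(i, j). hartley d N (g i) (g j))"
  define D where "D = mat n n (\<lambda>(i, j). if i = j then torus_mu d N (g i) else 0)"
  define Q where "Q = (1 / real n) \<cdot>\<^sub>m H"
  have A: "A = mat n n (\<lambda>(i, j). if E (g i) (g j) then 1 else 0)"
    by (simp add: A_def torus_adjacency_matrix_def adjacency_matrix_def V_def E_def n_def g_def)
  have carr: "A \<in> carrier_mat n n" "H \<in> carrier_mat n n" "D \<in> carrier_mat n n" "Q \<in> carrier_mat n n"
    by (simp_all add: A H_def D_def Q_def)
  have HH: "H * H = real n \<cdot>\<^sub>m 1\<^sub>m n"
  proof (rule eq_matI)
    fix i j assume "i < dim_row (real n \<cdot>\<^sub>m 1\<^sub>m n)" "j < dim_col (real n \<cdot>\<^sub>m 1\<^sub>m n)"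
    hence ij: "i < n" "j < n" by auto
    have "(H * H) $$ (i, j) = (\<Sum>l\<in>{0..<n}. hartley d N (g i) (g l) * hartley d N (g l) (g j))"
      using ij by (simp add: H_def scalar_prod_def)
    also have "\<dots> = (\<Sum>v\<in>V. hartley d N (g i) v * hartley d N v (g j))"
      by (rule sum_g)
    also have "\<dots> = (if i = j then real n else 0)"
      using hartley_orthogonal[OF N0 gV[OF ij(1), unfolded V_def] gV[OF ij(2), unfolded V_def]] g_inj[OF ij]
      by (simp add: V_def n)
    finally show "(H * H) $$ (i, j) = (real n \<cdot>\<^sub>m 1\<^sub>m n) $$ (i, j)" using ij by simp
  qed (simp_all add: H_def)
  have HQ: "H * Q = 1\<^sub>m n"
  proof -
    have "H * Q = (1 / real n) \<cdot>\<^sub>m (H * H)"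
      unfolding Q_def by (rule mult_smult_distrib[OF carr(2) carr(2)])
    also have "\<dots> = 1\<^sub>m n" unfolding HH using n0 by (intro eq_matI) auto
    finally show ?thesis .
  qed
  have QH: "Q * H = 1\<^sub>m n" by (rule mat_mult_left_right_inverse[OF carr(2,4) HQ])
  have AH: "A * H = H * D"
  proof (rule eq_matI)
    fix i j assume "i < dim_row (H * D)" "j < dim_col (H * D)"
    hence ij: "i < n" "j < n" by (auto simp: H_def D_def)
    have Vi: "{v \<in> V. E (g i) v} = {v. E (g i) v}" by (auto simp: E_def V_def cayley_adj_def)
    have "(A * H) $$ (i, j) = (\<Sum>l\<in>{0..<n}. (if E (g i) (g l) then 1 else 0) * hartley d N (g l) (g j))"
      using ij by (simp add: A H_def scalar_prod_def)
    also have "\<dots> = (\<Sum>v\<in>V. (if E (g i) v then 1 else 0) * hartley d N v (g j))"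
      by (rule sum_g)
    also have "\<dots> = (\<Sum>v | E (g i) v. hartley d N v (g j))"
      unfolding Vi[symmetric] sum.inter_filter[OF finV] by (intro sum.cong) auto
    also have "\<dots> = torus_mu d N (g j) * hartley d N (g i) (g j)"
      unfolding E_def using hartley_eigenvector[OF N] gV[OF ij(1)] by (simp add: V_def)
    also have "\<dots> = (\<Sum>l\<in>{0..<n}. if l = j then hartley d N (g i) (g l) * torus_mu d N (g l) else 0)"
      using ij by simp
    also have "\<dots> = (\<Sum>l\<in>{0..<n}. hartley d N (g i) (g l) * (if l = j then torus_mu d N (g l) else 0))"
      by (intro sum.cong) auto
    also have "\<dots> = (H * D) $$ (i, j)"
      using ij by (simp add: H_def D_def scalar_prod_def)
    finally show "(A * H) $$ (i, j) = (H * D) $$ (i, j)" .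
  qed (simp_all add: A H_def D_def)
  have "A = A * (H * Q)" using carr unfolding HQ by simp
  also have "\<dots> = A * H * Q" using carr by (simp add: assoc_mult_mat[OF carr(1,2,4)])
  also have "\<dots> = H * D * Q" by (simp only: AH)
  finally have "similar_mat A D" using carr HQ QH by (intro similar_matI[of A D H Q n]) auto
  hence "char_poly A = char_poly D" by (rule char_poly_similar)
  also have "\<dots> = (\<Prod>a\<leftarrow>diag_mat D. [:- a, 1:])"
    by (rule char_poly_upper_triangular[OF carr(3)]) (auto simp: D_def upper_triangular_def)
  also have "diag_mat D = map (\<lambda>i. torus_mu d N (g i)) [0..<n]"
    by (auto simp: diag_mat_def D_def)
  finally have "proots (char_poly A) = mset (map (\<lambda>i. torus_mu d N (g i)) [0..<n])"
    by (simp only: proots_prod_linear_factors)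
  also have "\<dots> = image_mset (\<lambda>i. torus_mu d N (g i)) (mset_set {0..<n})"
    by simp
  also have "\<dots> = image_mset (torus_mu d N) (image_mset g (mset_set {0..<n}))"
    by (simp add: multiset.map_comp comp_def)
  also have "image_mset g (mset_set {0..<n}) = mset_set V"
    using g by (simp add: bij_betw_def image_mset_mset_set)
  finally show ?thesis by (simp add: A_def V_def)
qed

section \<open>Density of eigenvalues at the edges\<close>

text \<open>If the entry at 0-based position \<open>k - 1\<close> of a descending list is at most
  \<open>t\<close>, only the \<open>k - 1\<close> entries before it can exceed
  \<open>t\<close>.\<close>

lemma nth_sorted_desc_gt:
  fixes M :: "real multiset"
  assumes "k > 0" "k \<le> size (filter_mset (\<lambda>x. x > t) M)"
  shows "rev (sorted_list_of_multiset M) ! (k - 1) > t"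
proof (rule ccontr)
  define xs where "xs = rev (sorted_list_of_multiset M)"
  assume "\<not> ?thesis"
  hence le: "xs ! (k - 1) \<le> t" by (simp add: xs_def)
  have "size (filter_mset (\<lambda>x. x > t) M) = length (filter (\<lambda>x. x > t) xs)"
    by (metis mset_filter mset_rev mset_sorted_list_of_multiset size_mset xs_def)
  also have "\<dots> = card {i. i < length xs \<and> xs ! i > t}" by (rule length_filter_conv_card)
  also have "{i. i < length xs \<and> xs ! i > t} \<subseteq> {..<k - 1}"
  proof safe
    fix i assume i: "i < length xs" "xs ! i > t"
    have "xs ! i \<le> xs ! (k - 1)" if "k - 1 \<le> i"
      by (rule sorted_rev_nth_mono[OF _ that i(1)]) (simp add: xs_def)
    with i le show "i < k - 1" by force
  qed
  hence "card {i. i < length xs \<and> xs ! i > t} \<le> card {..<k - 1}" by (rule card_mono[rotated]) simp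
  finally show False using assms by simp
qed

text \<open>Mirror image: if that entry is at least \<open>t\<close>, entries below \<open>t\<close>
  can stand only at the \<open>size M - k\<close> positions after it.\<close>

lemma nth_sorted_desc_less:
  fixes M :: "real multiset"
  assumes "k > 0" "k \<le> size M" "size M - k < size (filter_mset (\<lambda>x. x < t) M)"
  shows "rev (sorted_list_of_multiset M) ! (k - 1) < t"
proof (rule ccontr)
  define xs where "xs = rev (sorted_list_of_multiset M)"
  assume "\<not> ?thesis"
  hence le: "xs ! (k - 1) \<ge> t" by (simp add: xs_def)
  have len: "length xs = size M"
    by (metis length_rev mset_sorted_list_of_multiset size_mset xs_def)
  have "size (filter_mset (\<lambda>x. x < t) M) = length (filter (\<lambda>x. x < t) xs)"
    by (metis mset_filter mset_rev mset_sorted_list_of_multiset size_mset xs_def)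
  also have "\<dots> = card {i. i < length xs \<and> xs ! i < t}" by (rule length_filter_conv_card)
  also have "{i. i < length xs \<and> xs ! i < t} \<subseteq> {k..<size M}"
  proof safe
    fix i assume i: "i < length xs" "xs ! i < t"
    have "xs ! (k - 1) \<le> xs ! i" if "i \<le> k - 1"
      using that assms len by (intro sorted_rev_nth_mono) (auto simp: xs_def)
    with i le len assms(1) show "i \<in> {k..<size M}" by force
  qed
  hence "card {i. i < length xs \<and> xs ! i < t} \<le> card {k..<size M}" by (rule card_mono[rotated]) simp
  finally show False using assms by simp
qed

text \<open>By \<open>cos y = 1 - 2 * sin (y / 2) ^ 2\<close>; the crude bound \<open>pi < 4\<close>
  already gives \<open>y / 2 < 1 / (2 * d)\<close>.\<close>

lemma cos_gt_1_minus_inverse: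
  fixes d :: nat and y :: real
  assumes "d \<ge> 1" "0 \<le> y" "y \<le> pi / (5 * real d)"
  shows "cos y > 1 - 1 / real d"
proof -
  have d: "real d \<ge> 1" using assms(1) by simp
  have "\<bar>sin (y / 2)\<bar> \<le> y / 2" using abs_sin_x_le_abs_x[of "y / 2"] assms(2) by simp
  also have "y / 2 \<le> 4 / (5 * real d) / 2"
    using assms(3) pi_less_4 d by (intro divide_right_mono order.trans[OF assms(3)]) auto
  also have "\<dots> < 1 / (2 * real d)" using d by (simp add: field_simps)
  finally have "\<bar>sin (y / 2)\<bar> ^ 2 < (1 / (2 * real d)) ^ 2" by (intro power_strict_mono) auto
  hence "2 * sin (y / 2) ^ 2 < 1 / (2 * real d * real d)" by (simp add: power2_eq_square)
  also have "\<dots> \<le> 1 / real d" using d by (simp add: field_simps)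
  finally show ?thesis using cos_double_sin[of "y / 2"] by simp
qed

text \<open>Every tuple with all coordinates in a window of length \<open>N / (10 * d)\<close>
  starting at \<open>a\<close> qualifies, because its \<open>d\<close> signed cosines sum to more
  than \<open>d - 1\<close>.\<close>

lemma card_edge_ge:
  fixes a \<sigma> :: real
  assumes d: "d \<ge> 1" and N: "N \<ge> 20 * d" and a: "0 \<le> a" "a \<le> real N / 2"
    and \<sigma>: "\<And>x :: int. a \<le> of_int x \<Longrightarrow> of_int x \<le> a + real N / (10 * real d) \<Longrightarrow>
      \<sigma> * cos (2 * of_int x * pi / of_nat N) > 1 - 1 / real d"
  shows "(1 / (20 * real d)) ^ d * real N ^ d
    \<le> real (card {k \<in> carrier (torus_group d N). \<sigma> * torus_mu d N k > 2 * real d - 2})"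
proof -
  define r where "r = real N / (10 * real d)"
  define J where "J = {\<lceil>a\<rceil>..\<lfloor>a + r\<rfloor>}"
  have d1: "real d \<ge> 1" using d by simp
  have N0: "N > 0" using N d by simp
  have "real N \<ge> 20 * real d" using N by (metis of_nat_le_iff of_nat_mult of_nat_numeral)
  \<comment> \<open>A window of length at least 2 contains at least \<open>r - 1 \<ge> r / 2\<close>
    integers.\<close>
  hence r2: "r \<ge> 2" using d1 by (simp add: r_def field_simps)
  have "r \<le> real N / 10" using d1 N0 unfolding r_def by (intro divide_left_mono) auto
  hence aN: "a + r < real N" using a N0 by (simp add: field_simps)
  have J: "a \<le> of_int x" "of_int x \<le> a + r" "x \<in> {0..<int N}" if "x \<in> J" for x
  proof -
    show 1: "a \<le> of_int x" "of_int x \<le> a + r" using that by (auto simp: J_def ceiling_le_iff le_floor_iff)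
    have "0 \<le> (of_int x :: real)" "of_int x < real N" using 1 a aN by linarith+
    thus "x \<in> {0..<int N}" by auto
  qed
  have "real (card J) \<ge> r / 2"
  proof -
    have "of_int \<lceil>a\<rceil> < a + 1" "of_int \<lfloor>a + r\<rfloor> > a + r - 1" by linarith+
    hence "real_of_int (\<lfloor>a + r\<rfloor> - \<lceil>a\<rceil> + 1) \<ge> r / 2"
      unfolding of_int_add of_int_diff of_int_1 using r2 by linarith
    moreover have "real (card J) \<ge> of_int (\<lfloor>a + r\<rfloor> - \<lceil>a\<rceil> + 1)" by (simp add: J_def)
    ultimately show ?thesis by linarith
  qed
  hence "(r / 2) ^ d \<le> real (card J) ^ d" using r2 by (intro power_mono) auto
  moreover have "r / 2 = 1 / (20 * real d) * real N" by (simp add: r_def)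
  ultimately have "(1 / (20 * real d)) ^ d * real N ^ d \<le> real (card J) ^ d"
    by (simp only: power_mult_distrib)
  also have "\<dots> = real (card ({1..d} \<rightarrow>\<^sub>E J))" by (simp add: card_PiE)
  also have "card ({1..d} \<rightarrow>\<^sub>E J) \<le> card {k \<in> carrier (torus_group d N). \<sigma> * torus_mu d N k > 2 * real d - 2}"
  proof (rule card_mono)
    show "finite {k \<in> carrier (torus_group d N). \<sigma> * torus_mu d N k > 2 * real d - 2}"
      using finite_carrier_torus_group[OF N0] by simp
    show "{1..d} \<rightarrow>\<^sub>E J \<subseteq> {k \<in> carrier (torus_group d N). \<sigma> * torus_mu d N k > 2 * real d - 2}"
    proof safe
      fix k assume k: "k \<in> {1..d} \<rightarrow>\<^sub>E J"
      show "k \<in> carrier (torus_group d N)"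
        using k J(3) by (auto simp: carrier_torus_group[OF N0] PiE_iff)
      have "real d - 1 = real d * (1 - 1 / real d)" using d1 by (simp add: field_simps)
      also have "\<dots> = (\<Sum>j=1..d. 1 - 1 / real d)" by simp
      also have "\<dots> < (\<Sum>j=1..d. \<sigma> * cos (2 * of_int (k j) * pi / of_nat N))"
        using d k J by (intro sum_strict_mono \<sigma>) (auto simp: PiE_iff r_def)
      also have "\<dots> = \<sigma> * torus_mu d N k / 2" by (simp add: torus_mu_def flip: sum_distrib_left)
      finally show "\<sigma> * torus_mu d N k > 2 * real d - 2" by simp
    qed
  qed
  finally show ?thesis by simp
qed

lemma card_top_edge_ge:
  assumes d: "d \<ge> 1" and N: "N \<ge> 20 * d"
  shows "(1 / (20 * real d)) ^ d * real N ^ d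
    \<le> real (card {k \<in> carrier (torus_group d N). torus_mu d N k > 2 * real d - 2})"
proof -
  have N0: "real N > 0" using N d by simp
  have "1 * cos (2 * of_int x * pi / of_nat N) > 1 - 1 / real d"
    if "0 \<le> real_of_int x" "of_int x \<le> 0 + real N / (10 * real d)" for x
  proof -
    have "2 * of_int x * pi / real N \<le> 2 * (real N / (10 * real d)) * pi / real N"
      using that N0 by (intro divide_right_mono mult_right_mono mult_left_mono) auto
    also have "\<dots> = pi / (5 * real d)" using N0 d by (simp add: field_simps)
    finally show ?thesis using cos_gt_1_minus_inverse[OF d] that N0 by simp
  qed
  from card_edge_ge[where a = 0, OF d N _ _ this] show ?thesis by simp
qed

lemma card_bottom_edge_ge:
  assumes d: "d \<ge> 1" and N: "N \<ge> 20 * d"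
  shows "(1 / (20 * real d)) ^ d * real N ^ d
    \<le> real (card {k \<in> carrier (torus_group d N). torus_mu d N k < - (2 * real d - 2)})"
proof -
  have N0: "real N > 0" using N d by simp
  have "-1 * cos (2 * of_int x * pi / of_nat N) > 1 - 1 / real d"
    if x: "real N / 2 \<le> real_of_int x" "of_int x \<le> real N / 2 + real N / (10 * real d)" for x
  proof -
    \<comment> \<open>The angle is measured from \<open>pi\<close>, where the cosine is -1. For odd
      \<open>N\<close> the window starts at a non-integer, which does no harm.\<close>
    define y where "y = 2 * (of_int x - real N / 2) * pi / real N"
    have y: "2 * of_int x * pi / real N = y + pi" using N0 by (simp add: y_def field_simps)
    have "y \<le> 2 * (real N / (10 * real d)) * pi / real N"
      unfolding y_def using x N0 by (intro divide_right_mono mult_right_mono mult_left_mono) auto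
    also have "\<dots> = pi / (5 * real d)" using N0 d by (simp add: field_simps)
    finally have "y \<le> pi / (5 * real d)" .
    moreover have "0 \<le> y" using x N0 by (simp add: y_def)
    ultimately show ?thesis unfolding y using cos_gt_1_minus_inverse[OF d, of y] by simp
  qed
  from card_edge_ge[where a = "real N / 2", OF d N _ _ this] have "(1 / (20 * real d)) ^ d * real N ^ d
    \<le> real (card {k \<in> carrier (torus_group d N). -1 * torus_mu d N k > 2 * real d - 2})" by simp
  moreover have "-1 * torus_mu d N k > 2 * real d - 2 \<longleftrightarrow> torus_mu d N k < - (2 * real d - 2)" for k
    by linarith
  ultimately show ?thesis by (simp only:)
qed

lemma size_filter_torus_spectrum:
  assumes "N > 0"
  shows "size (filter_mset P (image_mset (torus_mu d N) (mset_set (carrier (torus_group d N)))))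
    = card {k \<in> carrier (torus_group d N). P (torus_mu d N k)}"
  using finite_carrier_torus_group[OF assms]
  by (simp add: filter_mset_image_mset filter_mset_mset_set)

theorem theorem3:
  fixes d :: nat
  assumes "d \<ge> 1"
  shows "\<exists>c C :: real. 0 < c \<and> c \<le> 1 / 2 \<and>
    (\<forall>N::nat. N \<ge> 3 \<longrightarrow>
      (\<forall>k::nat. real k \<in> {1..<c * real N ^ d} \<union> {(1 - c) * real N ^ d<..real N ^ d} \<longrightarrow>
        real (torus_multiplicity d N (torus_eigenvalue d N k)) \<le> C))"
proof -
  \<comment> \<open>\<open>c\<close> is the proportion of tuples guaranteed at each edge,
    \<open>C1\<close> bounds the trivial estimate \<open>N ^ d\<close> when
    \<open>N < 20 * d\<close>, and \<open>C2\<close> comes from Mann's theorem.\<close>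
  define c where "c = (1 / (20 * real d)) ^ d"
  define C1 :: nat where "C1 = (20 * d) ^ d"
  define C2 :: nat where "C2 = (2 * d * fact (4 * d)) ^ d"
  have d1: "real d \<ge> 1" using assms by simp
  have c0: "c > 0" using d1 by (simp add: c_def)
  have c12: "c \<le> 1 / 2"
  proof -
    have "c \<le> (1 / (20 * real d)) ^ 1"
      unfolding c_def using d1 assms by (intro power_decreasing) auto
    also have "\<dots> \<le> 1 / 2" using d1 by (simp add: field_simps)
    finally show ?thesis .
  qed
  have "torus_multiplicity d N (torus_eigenvalue d N k) \<le> C1 + C2"
    if N: "N \<ge> 3" and k: "real k \<in> {1..<c * real N ^ d} \<union> {(1 - c) * real N ^ d<..real N ^ d}" for N k
  proof (cases "N \<ge> 20 * d")
    case False
    have "torus_multiplicity d N (torus_eigenvalue d N k) \<le> N ^ d"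
      using N by (intro torus_multiplicity_le) simp
    also have "\<dots> \<le> C1" unfolding C1_def using False by (intro power_mono) auto
    finally show ?thesis by simp
  next
    case True
    have N0: "N > 0" using N by simp
    define M where "M = image_mset (torus_mu d N) (mset_set (carrier (torus_group d N)))"
    have sizeM: "size M = N ^ d" by (simp add: M_def card_carrier_torus_group[OF N0])
    have ev: "torus_eigenvalue d N k = rev (sorted_list_of_multiset M) ! (k - 1)"
      by (simp add: torus_eigenvalue_def eigenvalues_desc_def proots_char_poly_torus[OF N] M_def)
    have Nd: "real N ^ d > 0" using N0 by simp
    have "\<exists>\<sigma>. (\<sigma> = 1 \<or> \<sigma> = -1) \<and> \<sigma> * torus_eigenvalue d N k > 2 * real d - 2"
    proof (cases "real k \<in> {1..<c * real N ^ d}")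
      case top: True
      have "real k \<le> real (size (filter_mset (\<lambda>x. x > 2 * real d - 2) M))"
        using top card_top_edge_ge[OF assms True]
        unfolding M_def size_filter_torus_spectrum[OF N0] c_def by simp
      hence "torus_eigenvalue d N k > 2 * real d - 2"
        unfolding ev using top by (intro nth_sorted_desc_gt) auto
      thus ?thesis by (intro exI[of _ 1]) simp
    next
      case False
      hence bot: "(1 - c) * real N ^ d < real k" "real k \<le> real N ^ d" using k by auto
      have "0 \<le> (1 - c) * real N ^ d" using c12 Nd by simp
      hence k0: "k > 0" using bot(1) by (cases k) auto
      have kN: "k \<le> size M" using bot(2) unfolding sizeM by (simp flip: of_nat_power)
      \<comment> \<open>Fewer eigenvalues follow position \<open>k\<close> than lie below the lower
        threshold, so the \<open>k\<close>-th one lies below it too.\<close>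
      have "real (size M - k) = real N ^ d - real k" using kN by (simp add: of_nat_diff sizeM)
      also have "\<dots> < c * real N ^ d" using bot(1) by (simp add: algebra_simps)
      also have "\<dots> \<le> real (size (filter_mset (\<lambda>x. x < - (2 * real d - 2)) M))"
        using card_bottom_edge_ge[OF assms True]
        unfolding M_def size_filter_torus_spectrum[OF N0] c_def .
      finally have "torus_eigenvalue d N k < - (2 * real d - 2)"
        unfolding ev by (intro nth_sorted_desc_less[OF k0 kN]) simp
      thus ?thesis by (intro exI[of _ "-1"]) simp
    qed
    then obtain \<sigma> where "\<sigma> = 1 \<or> \<sigma> = -1" "\<sigma> * torus_eigenvalue d N k > 2 * real d - 2" by blast
    from torus_multiplicity_edge_le[OF N0 this] show ?thesis by (simp add: C2_def)
  qed
  hence "real (torus_multiplicity d N (torus_eigenvalue d N k)) \<le> real (C1 + C2)"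
    if "N \<ge> 3" "real k \<in> {1..<c * real N ^ d} \<union> {(1 - c) * real N ^ d<..real N ^ d}" for N k
    using that of_nat_le_iff by blast
  with c0 c12 show ?thesis by blast
qed

end
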